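(* Let $A\in M_n(\mathbb{R}_+)$ and let $1\le k\le n$ be an integer. Then: (i) $W_{\max}^k(\alpha A\oplus\beta I)=\alpha W_{\max}^k(A)\oplus\beta$, $W_{\max}^k(A\oplus B)\subseteq W_{\max}^k(A)\oplus W_{\max}^k(B)$, and $W_{\max}^n(A\oplus B)=W_{\max}^n(A)\oplus W_{\max}^n(B)$, for all $\alpha,\beta\in\mathbb{R}_+$ and $B\in M_n(\mathbb{R}_+)$. (ii) $W_{\max}^k(U^t\otimes A\otimes U)=W_{\max}^k(A)$ for every $U\in\mathcal{U}_n$. (iii) If $B\in M_m(\mathbb{R}_+)$ is a principal submatrix of $A$ and $k\le m$, then $W_{\max}^k(B)\subseteq W_{\max}^k(A)$. Consequently, if $V=[e_{i_1},e_{i_2},\ldots,e_{i_s}]\in M_{n\times s}(\mathbb{R}_+)$ with $i_1,\dots,i_s\in\{1,\dots,n\}$ pairwise distinct and $1\le k\le s\le n$, then $W_{\max}^k(V^t\otimes A\otimes V)\subseteq W_{\max}^k(A)$, and equality holds if $s=n$. (iv) $W_{\max}^k(A^t)=W_{\max}^k(A)$. (v) If $k<n$, then $W_{\max}^{k+1}(A)\subseteq W_{\max}^k(A)$. Consequently, $W_{\max}^n(A)\subseteq W_{\max}^{n-1}(A)\subseteq\cdots\subseteq W_{\max}^2(A)\subseteq W_{\max}(A)$, where $W_{\max}(A)=W_{\max}^1(A)$.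
   Context: $\mathbb{R}_+$ is the set of nonnegative reals, $M_{m\times n}(\mathbb{R}_+)$ the set of $m\times n$ matrices with nonnegative real entries, and $M_n(\mathbb{R}_+)=M_{n\times n}(\mathbb{R}_+)$. Max algebra: $a\oplus b=\max\{a,b\}$; for matrices, $(A\oplus B)_{ij}=\max\{a_{ij},b_{ij}\}$ and, for compatible sizes, $(A\otimes B)_{ij}=\max_l a_{il}b_{lj}$. For a square matrix, $tr_\otimes(A)=\max_i a_{ii}$. $I=I_n$ is the usual identity matrix; $e_l$ is the $l$th standard basis vector of $\mathbb{R}^n$. $\mathcal{U}_n=\{U\in M_n(\mathbb{R}_+): U^t\otimes U=U\otimes U^t=I_n\}$ (this is the group of $n\times n$ permutation matrices). For $1\le k\le n$ let $\mathcal{X}_{n\times k}=\{X\in M_{n\times k}(\mathbb{R}_+): X^t\otimes X=I_k\}$, and define the max $k$-numerical range $W_{\max}^k(A)=\{tr_\otimes(X^t\otimes A\otimes X): X\in\mathcal{X}_{n\times k}\}$ for $A \in M_n(\mathbb{R}_+)$ (for a matrix of another size $m\ge k$, use $\mathcal{X}_{m\times k}$). For sets $S,T\subseteq\mathbb{R}_+$ and $\alpha,\beta\in\mathbb{R}_+$: $S\oplus T=\{s\oplus t: s\in S,t\in T\}$, $\alpha S=\{\alpha s:s\in S\}$, $S\oplus\beta=\{s\oplus\beta:s\in S\}$. *)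

theory Defs
  imports Complex_Main "Jordan_Normal_Form.Matrix" "Jordan_Normal_Form.DL_Submatrix"
begin

definition nonneg_mats :: "nat \<Rightarrow> nat \<Rightarrow> real mat set" where
  "nonneg_mats m n = {A \<in> carrier_mat m n. \<forall>i<m. \<forall>j<n. 0 \<le> A $$ (i, j)}"

text \<open>Matrix operations of max algebra. The maxima in the product and in the trace are
  meaningful only over nonempty index ranges, i.e. for a positive inner dimension and a
  positive size, respectively.\<close>

definition oplus_max_mat :: "real mat \<Rightarrow> real mat \<Rightarrow> real mat" (infixl \<open>\<oplus>\<^sub>m\<close> 65) where
  "A \<oplus>\<^sub>m B = mat (dim_row A) (dim_col A) (\<lambda>(i, j). max (A $$ (i, j)) (B $$ (i, j)))"

definition otimes_max_mat :: "real mat \<Rightarrow> real mat \<Rightarrow> real mat" (infixl \<open>\<otimes>\<^sub>m\<close> 70) where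
  "A \<otimes>\<^sub>m B = mat (dim_row A) (dim_col B)
     (\<lambda>(i, j). MAX l\<in>{..<dim_col A}. A $$ (i, l) * B $$ (l, j))"

definition tr_max :: "real mat \<Rightarrow> real" where
  "tr_max A = (MAX i\<in>{..<dim_row A}. A $$ (i, i))"

definition max_unitary_mats :: "nat \<Rightarrow> real mat set" where
  "max_unitary_mats n =
     {U \<in> nonneg_mats n n. transpose_mat U \<otimes>\<^sub>m U = 1\<^sub>m n \<and> U \<otimes>\<^sub>m transpose_mat U = 1\<^sub>m n}"

definition max_isometries :: "nat \<Rightarrow> nat \<Rightarrow> real mat set" where
  "max_isometries n k = {X \<in> nonneg_mats n k. transpose_mat X \<otimes>\<^sub>m X = 1\<^sub>m k}"

text \<open>The size of the square matrix \<open>A\<close> is read off from its row dimension.\<close>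

definition max_k_numerical_range :: "nat \<Rightarrow> real mat \<Rightarrow> real set" where
  "max_k_numerical_range k A =
     {tr_max (transpose_mat X \<otimes>\<^sub>m A \<otimes>\<^sub>m X) | X. X \<in> max_isometries (dim_row A) k}"

definition max_numerical_range :: "real mat \<Rightarrow> real set" where
  "max_numerical_range A = max_k_numerical_range 1 A"

definition oplus_max_set :: "real set \<Rightarrow> real set \<Rightarrow> real set" (infixl \<open>\<oplus>\<^sub>s\<close> 65) where
  "S \<oplus>\<^sub>s T = {max s t | s t. s \<in> S \<and> t \<in> T}"

text \<open>The rows and columns kept are indexed by the same set and stay in their original order.\<close>

definition principal_submatrix :: "real mat \<Rightarrow> real mat \<Rightarrow> bool" where
  "principal_submatrix B A \<longleftrightarrow> (\<exists>I\<subseteq>{..<dim_row A}. B = submatrix A I I)"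

end

theory Submission
  imports Defs
begin

text \<open>
  Every part is a consequence of matrix algebra over the idempotent semiring of nonnegative
  reals with \<open>max\<close> and multiplication. Over nonempty index ranges the product \<open>\<otimes>\<^sub>m\<close> is
  associative, distributes over \<open>\<oplus>\<^sub>m\<close> and reverses under transposition, and the trace is linear;
  transposition invariance and the behaviour of the range under \<open>\<alpha> A \<oplus> \<beta> I\<close> and \<open>A \<oplus> B\<close> are
  then read off from the values at a single isometry.

  The inclusions come from one observation: if \<open>V\<close> is an isometry then so is \<open>V \<otimes>\<^sub>m X\<close> for every
  isometry \<open>X\<close>, and the value of \<open>V\<^sup>t A V\<close> at \<open>X\<close> is the value of \<open>A\<close> at \<open>V \<otimes>\<^sub>m X\<close>
  (lemma \<open>max_k_numerical_range_compression\<close>). Principal submatrices are compressions by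
  matrices whose columns are distinct standard basis vectors, here called selection matrices.
  They also yield the monotonicity in \<open>k\<close>: the trace of \<open>X\<^sup>t A X\<close> is attained at one diagonal
  position, and as long as that position is kept one of the other columns of \<open>X\<close> can be dropped
  without changing the value.

  The statements about \<open>k = n\<close> rest on the fact that the columns of an isometry are nonzero
  with pairwise disjoint supports, so that a square isometry is a permutation matrix
  (lemma \<open>square_isometry_is_selection\<close>). Hence the \<open>n\<close>-th range is the single number \<open>tr_max A\<close>,
  and square isometries are unitary, which turns the compression inclusion into an equality.
\<close>

section \<open>Finite maxima\<close>

lemma MAX_swap:
  fixes f :: "'a \<Rightarrow> 'b \<Rightarrow> real"
  assumes "finite S" "S \<noteq> {}" "finite T" "T \<noteq> {}"
  shows "(MAX x\<in>S. MAX y\<in>T. f x y) = (MAX y\<in>T. MAX x\<in>S. f x y)"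
proof -
  have "(MAX x\<in>S. MAX y\<in>T. f x y) \<le> t \<longleftrightarrow> (MAX y\<in>T. MAX x\<in>S. f x y) \<le> t" for t
    using assms by auto
  then show ?thesis by (meson order.antisym order.refl)
qed

lemma MAX_max_distrib:
  fixes f g :: "'a \<Rightarrow> real"
  assumes "finite S" "S \<noteq> {}"
  shows "(MAX x\<in>S. max (f x) (g x)) = max (MAX x\<in>S. f x) (MAX x\<in>S. g x)"
proof -
  have "(MAX x\<in>S. max (f x) (g x)) \<le> t \<longleftrightarrow> max (MAX x\<in>S. f x) (MAX x\<in>S. g x) \<le> t" for t
    using assms by auto
  then show ?thesis by (meson order.antisym order.refl)
qed

lemma MAX_mult_left:
  fixes f :: "'a \<Rightarrow> real"
  assumes "finite S" "S \<noteq> {}" "0 \<le> c"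
  shows "c * (MAX x\<in>S. f x) = (MAX x\<in>S. c * f x)"
proof -
  have "mono (\<lambda>x. c * x)"
    using assms(3) by (auto intro!: monoI mult_left_mono)
  from mono_Max_commute[OF this, of "f ` S"] assms(1,2) show ?thesis
    by (simp add: image_image)
qed

lemma MAX_mult_right:
  fixes f :: "'a \<Rightarrow> real"
  assumes "finite S" "S \<noteq> {}" "0 \<le> c"
  shows "(MAX x\<in>S. f x) * c = (MAX x\<in>S. f x * c)"
  using MAX_mult_left[OF assms, of f] by (simp add: mult.commute)

section \<open>Matrix algebra over the max semiring\<close>

lemma nonneg_matsD:
  assumes "A \<in> nonneg_mats m n"
  shows "A \<in> carrier_mat m n" "dim_row A = m" "dim_col A = n"
    "\<And>i j. i < m \<Longrightarrow> j < n \<Longrightarrow> 0 \<le> A $$ (i, j)"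
  using assms by (auto simp: nonneg_mats_def)

lemma max_isometriesD:
  assumes "X \<in> max_isometries n k"
  shows "X \<in> nonneg_mats n k" "transpose_mat X \<otimes>\<^sub>m X = 1\<^sub>m k"
  using assms by (auto simp: max_isometries_def)

lemma dim_otimes_max_mat [simp]:
  "dim_row (A \<otimes>\<^sub>m B) = dim_row A" "dim_col (A \<otimes>\<^sub>m B) = dim_col B"
  by (simp_all add: otimes_max_mat_def)

lemma dim_oplus_max_mat [simp]:
  "dim_row (A \<oplus>\<^sub>m B) = dim_row A" "dim_col (A \<oplus>\<^sub>m B) = dim_col A"
  by (simp_all add: oplus_max_mat_def)

lemma index_otimes_max_mat:
  assumes "i < dim_row A" "j < dim_col B"
  shows "(A \<otimes>\<^sub>m B) $$ (i, j) = (MAX l\<in>{..<dim_col A}. A $$ (i, l) * B $$ (l, j))"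
  using assms by (simp add: otimes_max_mat_def)

lemma index_oplus_max_mat:
  assumes "i < dim_row A" "j < dim_col A"
  shows "(A \<oplus>\<^sub>m B) $$ (i, j) = max (A $$ (i, j)) (B $$ (i, j))"
  using assms by (simp add: oplus_max_mat_def)

lemma nonneg_mats_transpose:
  "A \<in> nonneg_mats m n \<Longrightarrow> transpose_mat A \<in> nonneg_mats n m"
  by (auto simp: nonneg_mats_def)

lemma nonneg_mats_one: "1\<^sub>m n \<in> nonneg_mats n n"
  by (auto simp: nonneg_mats_def)

lemma nonneg_mats_smult:
  "A \<in> nonneg_mats m n \<Longrightarrow> 0 \<le> \<alpha> \<Longrightarrow> \<alpha> \<cdot>\<^sub>m A \<in> nonneg_mats m n"
  by (auto simp: nonneg_mats_def)

lemma nonneg_mats_oplus: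
  assumes "A \<in> nonneg_mats m n" "B \<in> nonneg_mats m n"
  shows "A \<oplus>\<^sub>m B \<in> nonneg_mats m n"
  using nonneg_matsD[OF assms(1)] nonneg_matsD[OF assms(2)]
  by (auto simp: nonneg_mats_def index_oplus_max_mat max_def)

lemma nonneg_mats_otimes:
  assumes A: "A \<in> nonneg_mats m p" and B: "B \<in> nonneg_mats p n" and p: "0 < p"
  shows "A \<otimes>\<^sub>m B \<in> nonneg_mats m n"
proof -
  have "0 \<le> (MAX l\<in>{..<p}. A $$ (i, l) * B $$ (l, j))" if "i < m" "j < n" for i j
  proof -
    have "0 \<le> A $$ (i, 0) * B $$ (0, j)"
      using that p nonneg_matsD(4)[OF A] nonneg_matsD(4)[OF B] by simp
    also have "\<dots> \<le> (MAX l\<in>{..<p}. A $$ (i, l) * B $$ (l, j))"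
      using p by (intro Max_ge) auto
    finally show ?thesis .
  qed
  then show ?thesis
    using nonneg_matsD[OF A] nonneg_matsD[OF B]
    by (auto simp: nonneg_mats_def index_otimes_max_mat)
qed

lemma otimes_max_mat_assoc:
  assumes A: "A \<in> nonneg_mats m p" and B: "B \<in> nonneg_mats p q" and C: "C \<in> nonneg_mats q n"
    and pq: "0 < p" "0 < q"
  shows "(A \<otimes>\<^sub>m B) \<otimes>\<^sub>m C = A \<otimes>\<^sub>m (B \<otimes>\<^sub>m C)"
proof (rule eq_matI)
  fix i j assume "i < dim_row (A \<otimes>\<^sub>m (B \<otimes>\<^sub>m C))" "j < dim_col (A \<otimes>\<^sub>m (B \<otimes>\<^sub>m C))"
  then have ij: "i < m" "j < n"
    using nonneg_matsD[OF A] nonneg_matsD[OF C] by auto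
  note dims = nonneg_matsD(2,3)[OF A] nonneg_matsD(2,3)[OF B] nonneg_matsD(2,3)[OF C]
  have ne: "{..<p} \<noteq> {}" "{..<q} \<noteq> {}" using pq by auto
  have "((A \<otimes>\<^sub>m B) \<otimes>\<^sub>m C) $$ (i, j)
      = (MAX l\<in>{..<q}. (MAX r\<in>{..<p}. A $$ (i, r) * B $$ (r, l)) * C $$ (l, j))"
    using ij dims
    by (simp add: index_otimes_max_mat cong: image_cong_simp)
  also have "\<dots> = (MAX l\<in>{..<q}. MAX r\<in>{..<p}. A $$ (i, r) * (B $$ (r, l) * C $$ (l, j)))"
    using ij ne nonneg_matsD(4)[OF C]
    by (simp add: MAX_mult_right mult.assoc cong: image_cong_simp)
  also have "\<dots> = (MAX r\<in>{..<p}. MAX l\<in>{..<q}. A $$ (i, r) * (B $$ (r, l) * C $$ (l, j)))"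
    by (rule MAX_swap) (use ne in auto)
  also have "\<dots> = (MAX r\<in>{..<p}. A $$ (i, r) * (MAX l\<in>{..<q}. B $$ (r, l) * C $$ (l, j)))"
    using ij ne nonneg_matsD(4)[OF A] by (simp add: MAX_mult_left cong: image_cong_simp)
  also have "\<dots> = (A \<otimes>\<^sub>m (B \<otimes>\<^sub>m C)) $$ (i, j)"
    using ij dims by (simp add: index_otimes_max_mat cong: image_cong_simp)
  finally show "((A \<otimes>\<^sub>m B) \<otimes>\<^sub>m C) $$ (i, j) = (A \<otimes>\<^sub>m (B \<otimes>\<^sub>m C)) $$ (i, j)" .
qed simp_all

lemma transpose_otimes_max_mat:
  assumes "dim_col A = dim_row B"
  shows "transpose_mat (A \<otimes>\<^sub>m B) = transpose_mat B \<otimes>\<^sub>m transpose_mat A"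
  using assms
  by (intro eq_matI) (auto simp: index_otimes_max_mat mult.commute cong: image_cong_simp)

lemma otimes_oplus_distrib_left:
  assumes A: "A \<in> nonneg_mats m p" and B: "B \<in> nonneg_mats p n" and C: "C \<in> nonneg_mats p n"
    and p: "0 < p"
  shows "A \<otimes>\<^sub>m (B \<oplus>\<^sub>m C) = (A \<otimes>\<^sub>m B) \<oplus>\<^sub>m (A \<otimes>\<^sub>m C)"
proof -
  have "{..<p} \<noteq> {}" using p by auto
  then show ?thesis
    using nonneg_matsD[OF A] nonneg_matsD[OF B] nonneg_matsD[OF C]
    by (intro eq_matI)
      (auto simp: index_otimes_max_mat index_oplus_max_mat max_mult_distrib_left
         simp flip: MAX_max_distrib cong: image_cong_simp)
qed

lemma otimes_oplus_distrib_right: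
  assumes A: "A \<in> nonneg_mats p n" and B: "B \<in> nonneg_mats m p" and C: "C \<in> nonneg_mats m p"
    and p: "0 < p"
  shows "(B \<oplus>\<^sub>m C) \<otimes>\<^sub>m A = (B \<otimes>\<^sub>m A) \<oplus>\<^sub>m (C \<otimes>\<^sub>m A)"
proof -
  have "{..<p} \<noteq> {}" using p by auto
  then show ?thesis
    using nonneg_matsD[OF A] nonneg_matsD[OF B] nonneg_matsD[OF C]
    by (intro eq_matI)
      (auto simp: index_otimes_max_mat index_oplus_max_mat max_mult_distrib_right
         simp flip: MAX_max_distrib cong: image_cong_simp)
qed

lemma otimes_smult_right:
  assumes "dim_col A = dim_row B" "0 < dim_row B" "0 \<le> c"
  shows "A \<otimes>\<^sub>m (c \<cdot>\<^sub>m B) = c \<cdot>\<^sub>m (A \<otimes>\<^sub>m B)"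
proof -
  have "{..<dim_row B} \<noteq> {}" using assms by auto
  then show ?thesis
    using assms
    by (intro eq_matI)
      (auto simp: index_otimes_max_mat MAX_mult_left mult.left_commute cong: image_cong_simp)
qed

lemma otimes_smult_left:
  assumes "dim_col A = dim_row B" "0 < dim_row B" "0 \<le> c"
  shows "(c \<cdot>\<^sub>m A) \<otimes>\<^sub>m B = c \<cdot>\<^sub>m (A \<otimes>\<^sub>m B)"
proof -
  have "{..<dim_row B} \<noteq> {}" using assms by auto
  then show ?thesis
    using assms
    by (intro eq_matI)
      (auto simp: index_otimes_max_mat MAX_mult_left mult.assoc cong: image_cong_simp)
qed

lemma tr_max_oplus:
  assumes "A \<in> nonneg_mats k k" "B \<in> nonneg_mats k k" "0 < k"
  shows "tr_max (A \<oplus>\<^sub>m B) = max (tr_max A) (tr_max B)"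
proof -
  have "{..<k} \<noteq> {}" using assms(3) by auto
  then show ?thesis
    using nonneg_matsD[OF assms(1)] nonneg_matsD[OF assms(2)]
    by (simp add: tr_max_def index_oplus_max_mat MAX_max_distrib cong: image_cong_simp)
qed

lemma tr_max_smult:
  assumes "A \<in> nonneg_mats k k" "0 < k" "0 \<le> c"
  shows "tr_max (c \<cdot>\<^sub>m A) = c * tr_max A"
proof -
  have "{..<k} \<noteq> {}" using assms(2) by auto
  then show ?thesis
    using nonneg_matsD[OF assms(1)] assms(3)
    by (simp add: tr_max_def MAX_mult_left cong: image_cong_simp)
qed

lemma tr_max_one:
  assumes "0 < k"
  shows "tr_max (1\<^sub>m k) = 1"
  unfolding tr_max_def by (rule Max_eqI) (use assms in auto)

lemma tr_max_transpose:
  assumes "A \<in> carrier_mat k k"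
  shows "tr_max (transpose_mat A) = tr_max A"
  using assms by (simp add: tr_max_def cong: image_cong_simp)

section \<open>Selection matrices\<close>

text \<open>This is \<open>[e\<^bsub>f 0\<^esub>, \<dots>, e\<^bsub>f (m - 1)\<^esub>]\<close> in terms of standard basis vectors. Indexing by
  a function treats principal submatrices, lists of distinct basis vectors, permutation matrices and
  the deletion of a column alike.\<close>

definition selection_mat :: "nat \<Rightarrow> nat \<Rightarrow> (nat \<Rightarrow> nat) \<Rightarrow> real mat" where
  "selection_mat n m f = mat n m (\<lambda>(i, j). if i = f j then 1 else 0)"

lemma dim_selection_mat [simp]:
  "dim_row (selection_mat n m f) = n" "dim_col (selection_mat n m f) = m"
  by (simp_all add: selection_mat_def)

lemma nonneg_mats_selection: "selection_mat n m f \<in> nonneg_mats n m"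
  by (auto simp: nonneg_mats_def selection_mat_def)

lemma selection_mat_id: "selection_mat n n (\<lambda>i. i) = 1\<^sub>m n"
  by (intro eq_matI) (auto simp: selection_mat_def)

text \<open>In the maximum defining an entry only the term at the selected index survives; the
  others vanish and are dominated because the matrix is nonnegative.\<close>

lemma index_otimes_selection:
  assumes A: "A \<in> nonneg_mats p n" and "i < p" "j < m" "f j < n"
  shows "(A \<otimes>\<^sub>m selection_mat n m f) $$ (i, j) = A $$ (i, f j)"
proof -
  have "(MAX l\<in>{..<n}. A $$ (i, l) * (if l = f j then 1 else 0)) = A $$ (i, f j)"
    by (rule Max_eqI) (use assms nonneg_matsD(4)[OF A] in \<open>auto intro!: rev_image_eqI[of "f j"]\<close>)
  then show ?thesis
    using assms nonneg_matsD[OF A]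
    by (simp add: index_otimes_max_mat selection_mat_def cong: image_cong_simp)
qed

lemma otimes_one_right:
  assumes "A \<in> nonneg_mats m n"
  shows "A \<otimes>\<^sub>m 1\<^sub>m n = A"
  using nonneg_matsD[OF assms] index_otimes_selection[OF assms, of _ _ n "\<lambda>i. i"]
  by (intro eq_matI) (auto simp: selection_mat_id)

lemma otimes_one_left:
  assumes A: "A \<in> nonneg_mats m n"
  shows "1\<^sub>m m \<otimes>\<^sub>m A = A"
proof -
  have "transpose_mat (1\<^sub>m m \<otimes>\<^sub>m A) = transpose_mat A"
    using nonneg_matsD[OF A] otimes_one_right[OF nonneg_mats_transpose[OF A]]
    by (simp add: transpose_otimes_max_mat)
  then show ?thesis by (metis transpose_transpose)
qed

lemma selection_congruence:
  assumes A: "A \<in> nonneg_mats n n" and f: "\<And>j. j < m \<Longrightarrow> f j < n" and n: "0 < n"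
  shows "transpose_mat (selection_mat n m f) \<otimes>\<^sub>m A \<otimes>\<^sub>m selection_mat n m f
    = mat m m (\<lambda>(i, j). A $$ (f i, f j))"
proof -
  let ?S = "selection_mat n m f"
  have row: "(transpose_mat ?S \<otimes>\<^sub>m A) $$ (i, j) = A $$ (f i, j)" if "i < m" "j < n" for i j
  proof -
    have "transpose_mat ?S \<otimes>\<^sub>m A = transpose_mat (transpose_mat A \<otimes>\<^sub>m ?S)"
      using nonneg_matsD[OF A] by (simp add: transpose_otimes_max_mat)
    then show ?thesis
      using that f nonneg_matsD[OF A]
      by (simp add: index_otimes_selection[OF nonneg_mats_transpose[OF A]])
  qed
  have "transpose_mat ?S \<otimes>\<^sub>m A \<in> nonneg_mats m n"
    by (rule nonneg_mats_otimes[OF nonneg_mats_transpose[OF nonneg_mats_selection] A n])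
  from index_otimes_selection[OF this] show ?thesis
    using f by (intro eq_matI) (auto simp: row)
qed

lemma selection_mat_isometry:
  assumes f: "\<And>j. j < m \<Longrightarrow> f j < n" and inj: "inj_on f {..<m}"
  shows "selection_mat n m f \<in> max_isometries n m"
proof -
  let ?S = "selection_mat n m f"
  have "transpose_mat ?S \<otimes>\<^sub>m ?S = 1\<^sub>m m"
    using f inj
    by (intro eq_matI)
      (auto simp: index_otimes_selection[OF nonneg_mats_transpose[OF nonneg_mats_selection]],
       auto simp: selection_mat_def inj_on_def)
  then show ?thesis
    by (simp add: max_isometries_def nonneg_mats_selection)
qed

lemma mat_of_cols_unit_vec:
  assumes "length is = s"
  shows "mat_of_cols n (map (unit_vec n) is) = selection_mat n s (\<lambda>j. is ! j)"
  using assms by (intro eq_matI) (auto simp: selection_mat_def mat_of_cols_def unit_vec_def)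

text \<open>Row \<open>i\<close> of a principal submatrix is the row of the original matrix indexed by the
  \<open>i\<close>-th smallest member of the index set.\<close>

lemma principal_submatrix_selection:
  assumes A: "A \<in> nonneg_mats n n" and B: "B \<in> nonneg_mats m m" and m: "0 < m"
    and sub: "principal_submatrix B A"
  obtains V where "V \<in> max_isometries n m" "B = transpose_mat V \<otimes>\<^sub>m A \<otimes>\<^sub>m V"
proof -
  obtain I where I: "I \<subseteq> {..<n}" "B = submatrix A I I"
    using sub nonneg_matsD[OF A] by (auto simp: principal_submatrix_def)
  have "{i. i < n \<and> i \<in> I} = I" using I by auto
  then have m_card: "m = card I"
    using nonneg_matsD(2)[OF A] nonneg_matsD(2)[OF B] I(2) by (simp add: dim_submatrix)
  have pick_I: "pick I j \<in> I" if "j < m" for j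
    using pick_in_set_le that m_card by blast
  then have pick_n: "pick I j < n" if "j < m" for j
    using that I(1) by blast
  have "inj_on (pick I) {..<m}"
    using pick_mono_le[of _ I] unfolding m_card inj_on_def
    by (metis lessThan_iff linorder_neqE_nat less_irrefl)
  then have "selection_mat n m (pick I) \<in> max_isometries n m"
    using pick_n by (intro selection_mat_isometry)
  moreover have "B = mat m m (\<lambda>(i, j). A $$ (pick I i, pick I j))"
    using nonneg_matsD[OF A] nonneg_matsD[OF B] I \<open>{i. i < n \<and> i \<in> I} = I\<close> m_card
    by (intro eq_matI) (auto simp: submatrix_index)
  moreover have "transpose_mat (selection_mat n m (pick I)) \<otimes>\<^sub>m A \<otimes>\<^sub>m selection_mat n m (pick I)
      = mat m m (\<lambda>(i, j). A $$ (pick I i, pick I j))"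
    by (rule selection_congruence[OF A]) (use pick_n pick_n[OF m] in auto)
  ultimately show thesis
    using that by simp
qed

section \<open>Square isometries\<close>

lemma isometry_column_attains_one:
  assumes X: "X \<in> max_isometries n k" and n: "0 < n" and j: "j < k"
  obtains l where "l < n" "X $$ (l, j) = 1"
proof -
  note XN = nonneg_matsD[OF max_isometriesD(1)[OF X]]
  have "(transpose_mat X \<otimes>\<^sub>m X) $$ (j, j) = 1"
    using max_isometriesD(2)[OF X] j by simp
  then have "(MAX l\<in>{..<n}. X $$ (l, j) * X $$ (l, j)) = 1"
    using XN j by (simp add: index_otimes_max_mat cong: image_cong_simp)
  moreover have "(MAX l\<in>{..<n}. X $$ (l, j) * X $$ (l, j)) \<in> (\<lambda>l. X $$ (l, j) * X $$ (l, j)) ` {..<n}"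
    using n by (intro Max_in) auto
  ultimately obtain l where l: "l < n" "X $$ (l, j) * X $$ (l, j) = 1" by auto
  moreover have "0 \<le> X $$ (l, j)" using XN l j by simp
  ultimately have "X $$ (l, j) = 1"
    by (metis abs_of_nonneg abs_square_eq_1 power2_eq_square)
  with l that show thesis by blast
qed

lemma isometry_columns_disjoint:
  assumes X: "X \<in> max_isometries n k" and "i < k" "j < k" "i \<noteq> j" "l < n"
  shows "X $$ (l, i) = 0 \<or> X $$ (l, j) = 0"
proof -
  note XN = nonneg_matsD[OF max_isometriesD(1)[OF X]]
  have "(transpose_mat X \<otimes>\<^sub>m X) $$ (i, j) = 0"
    using max_isometriesD(2)[OF X] assms by simp
  then have "(MAX l\<in>{..<n}. X $$ (l, i) * X $$ (l, j)) = 0"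
    using XN assms by (simp add: index_otimes_max_mat cong: image_cong_simp)
  moreover have "X $$ (l, i) * X $$ (l, j) \<le> (MAX l\<in>{..<n}. X $$ (l, i) * X $$ (l, j))"
    using assms by (intro Max_ge) auto
  moreover have "0 \<le> X $$ (l, i) * X $$ (l, j)" using XN assms by simp
  ultimately show ?thesis by (metis mult_eq_0_iff order.antisym)
qed

text \<open>Choosing in every column a row with entry 1 is injective by disjointness of the supports,
  hence a permutation when there are as many columns as rows. Every row then already meets the
  support of one column in an entry 1, so that it has no other nonzero entry.\<close>

lemma square_isometry_is_selection:
  assumes X: "X \<in> max_isometries n n" and n: "0 < n"
  obtains f where "bij_betw f {..<n} {..<n}" "X = selection_mat n n f"
proof -
  have "\<forall>j\<in>{..<n}. \<exists>l. l < n \<and> X $$ (l, j) = 1"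
    using isometry_column_attains_one[OF X n] by (metis lessThan_iff)
  then obtain f where f: "\<And>j. j < n \<Longrightarrow> f j < n" "\<And>j. j < n \<Longrightarrow> X $$ (f j, j) = 1"
    by (metis lessThan_iff)
  have "inj_on f {..<n}"
    unfolding inj_on_def
    using isometry_columns_disjoint[OF X] f by (metis lessThan_iff zero_neq_one)
  moreover have "f ` {..<n} \<subseteq> {..<n}" using f by auto
  ultimately have bij: "bij_betw f {..<n} {..<n}"
    by (simp add: bij_betw_def endo_inj_surj)
  have "X $$ (l, j) = (if l = f j then 1 else 0)" if "l < n" "j < n" for l j
  proof -
    obtain i where i: "i < n" "l = f i"
      using bij_betw_imp_surj_on[OF bij] \<open>l < n\<close> by (metis imageE lessThan_iff)
    show ?thesis
      using isometry_columns_disjoint[OF X, of i j l] f i that by (cases "i = j") auto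
  qed
  then have "X = selection_mat n n f"
    using nonneg_matsD[OF max_isometriesD(1)[OF X]]
    by (intro eq_matI) (auto simp: selection_mat_def)
  with bij that show thesis by blast
qed

lemma square_isometry_unitary:
  assumes V: "V \<in> max_isometries n n" and n: "0 < n"
  shows "V \<in> max_unitary_mats n"
proof -
  obtain f where f: "bij_betw f {..<n} {..<n}" "V = selection_mat n n f"
    using square_isometry_is_selection[OF V n] .
  define g where "g = inv_into {..<n} f"
  have g: "g j < n" "f (g j) = j" if "j < n" for j
    using f(1) that unfolding g_def
    by (auto simp: bij_betw_def f_inv_into_f intro: inv_into_into[of _ f "{..<n}", simplified])
  have inj: "g (f j) = j" "f j < n" if "j < n" for j
    using f(1) that unfolding g_def by (auto simp: bij_betw_def)
  have Vt: "transpose_mat V = selection_mat n n g"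
    using g inj by (intro eq_matI) (auto simp: f(2) selection_mat_def)
  have "V \<otimes>\<^sub>m transpose_mat V = 1\<^sub>m n"
    unfolding Vt using g nonneg_matsD[OF max_isometriesD(1)[OF V]]
    by (intro eq_matI)
      (auto simp: index_otimes_selection[OF max_isometriesD(1)[OF V]],
       auto simp: f(2) selection_mat_def)
  then show ?thesis
    using max_isometriesD[OF V] by (simp add: max_unitary_mats_def)
qed

section \<open>The max numerical range\<close>

lemma max_k_numerical_range_eq:
  assumes "A \<in> nonneg_mats n n"
  shows "max_k_numerical_range k A
    = (\<lambda>X. tr_max (transpose_mat X \<otimes>\<^sub>m A \<otimes>\<^sub>m X)) ` max_isometries n k"
  using nonneg_matsD[OF assms] by (auto simp: max_k_numerical_range_def)

lemma congruence_nonneg: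
  assumes "A \<in> nonneg_mats n n" "X \<in> nonneg_mats n k" "0 < n"
  shows "transpose_mat X \<otimes>\<^sub>m A \<otimes>\<^sub>m X \<in> nonneg_mats k k"
  using assms by (intro nonneg_mats_otimes[of _ _ n] nonneg_mats_transpose)

text \<open>The reason why compressions shrink the range: evaluating \<open>A\<close> at a product \<open>V X\<close> amounts to
  evaluating the compression \<open>V\<^sup>t A V\<close> at \<open>X\<close>.\<close>

lemma congruence_otimes:
  assumes A: "A \<in> nonneg_mats n n" and V: "V \<in> nonneg_mats n s" and X: "X \<in> nonneg_mats s k"
    and pos: "0 < n" "0 < s"
  shows "transpose_mat (V \<otimes>\<^sub>m X) \<otimes>\<^sub>m A \<otimes>\<^sub>m (V \<otimes>\<^sub>m X)
    = transpose_mat X \<otimes>\<^sub>m (transpose_mat V \<otimes>\<^sub>m A \<otimes>\<^sub>m V) \<otimes>\<^sub>m X"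
proof -
  note Xt = nonneg_mats_transpose[OF X] and Vt = nonneg_mats_transpose[OF V]
  note VtA = nonneg_mats_otimes[OF Vt A pos(1)]
  have "transpose_mat (V \<otimes>\<^sub>m X) \<otimes>\<^sub>m A \<otimes>\<^sub>m (V \<otimes>\<^sub>m X)
      = (transpose_mat X \<otimes>\<^sub>m transpose_mat V) \<otimes>\<^sub>m A \<otimes>\<^sub>m (V \<otimes>\<^sub>m X)"
    using nonneg_matsD[OF V] nonneg_matsD[OF X] by (simp add: transpose_otimes_max_mat)
  also have "\<dots> = transpose_mat X \<otimes>\<^sub>m (transpose_mat V \<otimes>\<^sub>m A) \<otimes>\<^sub>m (V \<otimes>\<^sub>m X)"
    by (simp add: otimes_max_mat_assoc[OF Xt Vt A pos(2,1)])
  also have "\<dots> = (transpose_mat X \<otimes>\<^sub>m (transpose_mat V \<otimes>\<^sub>m A) \<otimes>\<^sub>m V) \<otimes>\<^sub>m X"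
    by (rule otimes_max_mat_assoc[symmetric,
          OF nonneg_mats_otimes[OF Xt VtA pos(2)] V X pos])
  also have "\<dots> = transpose_mat X \<otimes>\<^sub>m (transpose_mat V \<otimes>\<^sub>m A \<otimes>\<^sub>m V) \<otimes>\<^sub>m X"
    by (simp add: otimes_max_mat_assoc[OF Xt VtA V pos(2,1)])
  finally show ?thesis .
qed

text \<open>The identity \<open>(V X)\<^sup>t (V X) = X\<^sup>t (V\<^sup>t V) X\<close> is the congruence law for the matrix \<open>1\<^sub>m n\<close>.\<close>

lemma isometry_otimes:
  assumes V: "V \<in> max_isometries n s" and X: "X \<in> max_isometries s k" and pos: "0 < n" "0 < s"
  shows "V \<otimes>\<^sub>m X \<in> max_isometries n k"
proof -
  note VN = max_isometriesD(1)[OF V] and XN = max_isometriesD(1)[OF X]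
  note VX = nonneg_mats_otimes[OF VN XN pos(2)]
  have "transpose_mat (V \<otimes>\<^sub>m X) \<otimes>\<^sub>m (V \<otimes>\<^sub>m X) = 1\<^sub>m k"
    using congruence_otimes[OF nonneg_mats_one VN XN pos]
    by (simp add: otimes_one_right[OF nonneg_mats_transpose[OF VX]]
        otimes_one_right[OF nonneg_mats_transpose[OF VN]]
        otimes_one_right[OF nonneg_mats_transpose[OF XN]]
        max_isometriesD(2)[OF V] max_isometriesD(2)[OF X])
  with VX show ?thesis by (simp add: max_isometries_def)
qed

lemma max_k_numerical_range_compression:
  assumes A: "A \<in> nonneg_mats n n" and V: "V \<in> max_isometries n s" and pos: "0 < n" "0 < s"
  shows "max_k_numerical_range k (transpose_mat V \<otimes>\<^sub>m A \<otimes>\<^sub>m V) \<subseteq> max_k_numerical_range k A"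
proof -
  note VN = max_isometriesD(1)[OF V]
  show ?thesis
    unfolding max_k_numerical_range_eq[OF A]
      max_k_numerical_range_eq[OF congruence_nonneg[OF A VN pos(1)]]
    using congruence_otimes[OF A VN max_isometriesD(1) pos, symmetric] isometry_otimes[OF V _ pos]
    by auto
qed

text \<open>The reverse inclusion compresses \<open>U\<^sup>t A U\<close> by the isometry \<open>U\<^sup>t\<close>, which restores \<open>A\<close>.\<close>

lemma max_k_numerical_range_unitary:
  assumes A: "A \<in> nonneg_mats n n" and U: "U \<in> max_unitary_mats n" and n: "0 < n"
  shows "max_k_numerical_range k (transpose_mat U \<otimes>\<^sub>m A \<otimes>\<^sub>m U) = max_k_numerical_range k A"
proof
  have UN: "U \<in> nonneg_mats n n" and UUt: "U \<otimes>\<^sub>m transpose_mat U = 1\<^sub>m n"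
    and UI: "U \<in> max_isometries n n"
    using U by (auto simp: max_unitary_mats_def max_isometries_def)
  note Ut = nonneg_mats_transpose[OF UN]
  have UtI: "transpose_mat U \<in> max_isometries n n"
    using Ut UUt by (simp add: max_isometries_def)
  let ?C = "transpose_mat U \<otimes>\<^sub>m A \<otimes>\<^sub>m U"
  show "max_k_numerical_range k ?C \<subseteq> max_k_numerical_range k A"
    by (rule max_k_numerical_range_compression[OF A UI n n])
  have "transpose_mat (transpose_mat U) \<otimes>\<^sub>m ?C \<otimes>\<^sub>m transpose_mat U = A"
    using congruence_otimes[OF A UN Ut n n]
    by (simp add: UUt otimes_one_left[OF A] otimes_one_right[OF A])
  then show "max_k_numerical_range k A \<subseteq> max_k_numerical_range k ?C"
    using max_k_numerical_range_compression[OF congruence_nonneg[OF A UN n] UtI n n, of k]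
    by simp
qed

lemma max_k_numerical_range_transpose:
  assumes A: "A \<in> nonneg_mats n n" and n: "0 < n"
  shows "max_k_numerical_range k (transpose_mat A) = max_k_numerical_range k A"
proof -
  have "tr_max (transpose_mat X \<otimes>\<^sub>m transpose_mat A \<otimes>\<^sub>m X) = tr_max (transpose_mat X \<otimes>\<^sub>m A \<otimes>\<^sub>m X)"
    if "X \<in> max_isometries n k" for X
  proof -
    note XN = max_isometriesD(1)[OF that]
    have "transpose_mat (transpose_mat X \<otimes>\<^sub>m A \<otimes>\<^sub>m X)
        = transpose_mat X \<otimes>\<^sub>m (transpose_mat A \<otimes>\<^sub>m X)"
      using nonneg_matsD[OF XN] nonneg_matsD[OF A] by (simp add: transpose_otimes_max_mat)
    also have "\<dots> = transpose_mat X \<otimes>\<^sub>m transpose_mat A \<otimes>\<^sub>m X"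
      using otimes_max_mat_assoc[OF nonneg_mats_transpose[OF XN] nonneg_mats_transpose[OF A] XN n n]
      by simp
    finally show ?thesis
      using tr_max_transpose[OF nonneg_matsD(1)[OF congruence_nonneg[OF A XN n]]] by simp
  qed
  then show ?thesis
    unfolding max_k_numerical_range_eq[OF A] max_k_numerical_range_eq[OF nonneg_mats_transpose[OF A]]
    by (intro image_cong) auto
qed

lemma tr_max_congruence_oplus:
  assumes A: "A \<in> nonneg_mats n n" and B: "B \<in> nonneg_mats n n" and X: "X \<in> nonneg_mats n k"
    and pos: "0 < n" "0 < k"
  shows "tr_max (transpose_mat X \<otimes>\<^sub>m (A \<oplus>\<^sub>m B) \<otimes>\<^sub>m X)
    = max (tr_max (transpose_mat X \<otimes>\<^sub>m A \<otimes>\<^sub>m X)) (tr_max (transpose_mat X \<otimes>\<^sub>m B \<otimes>\<^sub>m X))"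
proof -
  note Xt = nonneg_mats_transpose[OF X]
  show ?thesis
    by (simp add: otimes_oplus_distrib_left[OF Xt A B pos(1)]
        otimes_oplus_distrib_right[OF X nonneg_mats_otimes[OF Xt A pos(1)]
          nonneg_mats_otimes[OF Xt B pos(1)] pos(1)]
        tr_max_oplus[OF congruence_nonneg[OF A X pos(1)] congruence_nonneg[OF B X pos(1)] pos(2)])
qed

lemma tr_max_congruence_smult:
  assumes A: "A \<in> nonneg_mats n n" and X: "X \<in> nonneg_mats n k"
    and pos: "0 < n" "0 < k" and c: "0 \<le> c"
  shows "tr_max (transpose_mat X \<otimes>\<^sub>m (c \<cdot>\<^sub>m A) \<otimes>\<^sub>m X) = c * tr_max (transpose_mat X \<otimes>\<^sub>m A \<otimes>\<^sub>m X)"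
  using nonneg_matsD[OF X] nonneg_matsD[OF A] pos c
  by (simp add: otimes_smult_right otimes_smult_left
      tr_max_smult[OF congruence_nonneg[OF A X pos(1)] pos(2)])

lemma max_k_numerical_range_affine:
  assumes A: "A \<in> nonneg_mats n n" and pos: "0 < n" "0 < k" and \<alpha>: "0 \<le> \<alpha>" and \<beta>: "0 \<le> \<beta>"
  shows "max_k_numerical_range k ((\<alpha> \<cdot>\<^sub>m A) \<oplus>\<^sub>m (\<beta> \<cdot>\<^sub>m 1\<^sub>m n))
    = (\<lambda>s. max s \<beta>) ` ((\<lambda>s. \<alpha> * s) ` max_k_numerical_range k A)"
proof -
  note \<alpha>A = nonneg_mats_smult[OF A \<alpha>] and \<beta>I = nonneg_mats_smult[OF nonneg_mats_one \<beta>, of n]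
  have "tr_max (transpose_mat X \<otimes>\<^sub>m ((\<alpha> \<cdot>\<^sub>m A) \<oplus>\<^sub>m (\<beta> \<cdot>\<^sub>m 1\<^sub>m n)) \<otimes>\<^sub>m X)
      = max (\<alpha> * tr_max (transpose_mat X \<otimes>\<^sub>m A \<otimes>\<^sub>m X)) \<beta>" if "X \<in> max_isometries n k" for X
  proof -
    note XN = max_isometriesD(1)[OF that]
    show ?thesis
      by (simp add: tr_max_congruence_oplus[OF \<alpha>A \<beta>I XN pos] tr_max_congruence_smult[OF A XN pos \<alpha>]
          tr_max_congruence_smult[OF nonneg_mats_one XN pos \<beta>]
          otimes_one_right[OF nonneg_mats_transpose[OF XN]] max_isometriesD(2)[OF that]
          tr_max_one[OF pos(2)])
  qed
  then show ?thesis
    unfolding max_k_numerical_range_eq[OF A] max_k_numerical_range_eq[OF nonneg_mats_oplus[OF \<alpha>A \<beta>I]]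
      image_image by (intro image_cong) auto
qed

lemma max_k_numerical_range_oplus_subset:
  assumes A: "A \<in> nonneg_mats n n" and B: "B \<in> nonneg_mats n n" and pos: "0 < n" "0 < k"
  shows "max_k_numerical_range k (A \<oplus>\<^sub>m B) \<subseteq> max_k_numerical_range k A \<oplus>\<^sub>s max_k_numerical_range k B"
  unfolding max_k_numerical_range_eq[OF A] max_k_numerical_range_eq[OF B]
    max_k_numerical_range_eq[OF nonneg_mats_oplus[OF A B]] oplus_max_set_def
  using tr_max_congruence_oplus[OF A B max_isometriesD(1) pos] by blast

text \<open>Conjugating by a permutation matrix permutes the diagonal.\<close>

lemma max_k_numerical_range_full:
  assumes A: "A \<in> nonneg_mats n n" and n: "0 < n"
  shows "max_k_numerical_range n A = {tr_max A}"
proof -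
  have "tr_max (transpose_mat X \<otimes>\<^sub>m A \<otimes>\<^sub>m X) = tr_max A" if X: "X \<in> max_isometries n n" for X
  proof -
    obtain f where f: "bij_betw f {..<n} {..<n}" "X = selection_mat n n f"
      using square_isometry_is_selection[OF X n] .
    have fn: "f j < n" if "j < n" for j
      using f(1) that by (auto simp: bij_betw_def)
    have "transpose_mat X \<otimes>\<^sub>m A \<otimes>\<^sub>m X = mat n n (\<lambda>(i, j). A $$ (f i, f j))"
      unfolding f(2) by (rule selection_congruence[OF A _ n]) (rule fn)
    then have "tr_max (transpose_mat X \<otimes>\<^sub>m A \<otimes>\<^sub>m X) = (MAX i\<in>{..<n}. A $$ (f i, f i))"
      by (simp add: tr_max_def cong: image_cong_simp)
    also have "(\<lambda>i. A $$ (f i, f i)) ` {..<n} = (\<lambda>i. A $$ (i, i)) ` f ` {..<n}"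
      by (simp add: image_image)
    also have "f ` {..<n} = {..<n}" using f(1) by (simp add: bij_betw_def)
    finally show ?thesis using nonneg_matsD[OF A] by (simp add: tr_max_def)
  qed
  moreover have "max_isometries n n \<noteq> {}"
    using selection_mat_isometry[of n "\<lambda>i. i" n] by auto
  ultimately show ?thesis
    unfolding max_k_numerical_range_eq[OF A] by auto
qed

lemma max_k_numerical_range_full_oplus:
  assumes A: "A \<in> nonneg_mats n n" and B: "B \<in> nonneg_mats n n" and n: "0 < n"
  shows "max_k_numerical_range n (A \<oplus>\<^sub>m B) = max_k_numerical_range n A \<oplus>\<^sub>s max_k_numerical_range n B"
  unfolding max_k_numerical_range_full[OF A n] max_k_numerical_range_full[OF B n]
    max_k_numerical_range_full[OF nonneg_mats_oplus[OF A B] n] tr_max_oplus[OF A B n]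
  by (simp add: oplus_max_set_def)

text \<open>Let \<open>C = X\<^sup>t A X\<close> attain its trace at position \<open>p\<close>. Exchanging columns \<open>0\<close> and \<open>p\<close> of \<open>X\<close>
  and deleting the last column afterwards keeps column \<open>p\<close>, because \<open>k\<close> is positive.\<close>

lemma max_k_numerical_range_Suc_subset:
  assumes A: "A \<in> nonneg_mats n n" and pos: "0 < n" "0 < k"
  shows "max_k_numerical_range (k + 1) A \<subseteq> max_k_numerical_range k A"
proof
  fix t assume "t \<in> max_k_numerical_range (k + 1) A"
  then obtain X where X: "X \<in> max_isometries n (k + 1)"
    and t: "t = tr_max (transpose_mat X \<otimes>\<^sub>m A \<otimes>\<^sub>m X)"
    unfolding max_k_numerical_range_eq[OF A] by blast
  note XN = max_isometriesD(1)[OF X]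
  define C where "C = transpose_mat X \<otimes>\<^sub>m A \<otimes>\<^sub>m X"
  have C: "C \<in> nonneg_mats (k + 1) (k + 1)"
    unfolding C_def by (rule congruence_nonneg[OF A XN pos(1)])
  have t_C: "t = (MAX i\<in>{..<k + 1}. C $$ (i, i))"
    using t nonneg_matsD[OF C] by (simp add: C_def tr_max_def)
  have "t \<in> (\<lambda>i. C $$ (i, i)) ` {..<k + 1}"
    unfolding t_C by (intro Max_in) auto
  then obtain p where p: "p < k + 1" "t = C $$ (p, p)" by auto
  have C_le: "C $$ (i, i) \<le> t" if "i < k + 1" for i
    unfolding t_C using that by (intro Max_ge) auto
  define f where "f j = (if j = 0 then p else if j = p then 0 else j)" for j
  have f: "f j < k + 1" if "j < k" for j
    using that p by (auto simp: f_def)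
  have "inj_on f {..<k}"
    by (auto simp: f_def inj_on_def split: if_splits)
  then have S: "selection_mat (k + 1) k f \<in> max_isometries (k + 1) k"
    using f by (intro selection_mat_isometry)
  let ?Y = "X \<otimes>\<^sub>m selection_mat (k + 1) k f"
  have "transpose_mat ?Y \<otimes>\<^sub>m A \<otimes>\<^sub>m ?Y = mat k k (\<lambda>(i, j). C $$ (f i, f j))"
    using congruence_otimes[OF A XN nonneg_mats_selection pos(1), of k f]
      selection_congruence[OF C f]
    by (simp add: C_def)
  then have "tr_max (transpose_mat ?Y \<otimes>\<^sub>m A \<otimes>\<^sub>m ?Y) = (MAX i\<in>{..<k}. C $$ (f i, f i))"
    by (simp add: tr_max_def cong: image_cong_simp)
  also have "\<dots> = t"
  proof (rule Max_eqI)
    show "t \<in> (\<lambda>i. C $$ (f i, f i)) ` {..<k}"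
      using pos(2) p by (auto simp: f_def intro!: rev_image_eqI[of 0])
  qed (use C_le f in auto)
  finally show "t \<in> max_k_numerical_range k A"
    unfolding max_k_numerical_range_eq[OF A]
    using isometry_otimes[OF X S pos(1)] by (auto intro!: rev_image_eqI[of ?Y])
qed

section \<open>Properties of the max numerical range\<close>

theorem theorem3p4:
  fixes A :: "real mat" and n k :: nat
  assumes A: "A \<in> nonneg_mats n n"
    and k: "1 \<le> k" "k \<le> n"
  shows
    "((\<forall>\<alpha> \<ge> 0. \<forall>\<beta> \<ge> 0.
        max_k_numerical_range k ((\<alpha> \<cdot>\<^sub>m A) \<oplus>\<^sub>m (\<beta> \<cdot>\<^sub>m 1\<^sub>m n))
          = (\<lambda>s. max s \<beta>) ` ((\<lambda>s. \<alpha> * s) ` max_k_numerical_range k A))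
      \<and> (\<forall>B \<in> nonneg_mats n n.
        max_k_numerical_range k (A \<oplus>\<^sub>m B)
          \<subseteq> max_k_numerical_range k A \<oplus>\<^sub>s max_k_numerical_range k B)
      \<and> (\<forall>B \<in> nonneg_mats n n.
        max_k_numerical_range n (A \<oplus>\<^sub>m B)
          = max_k_numerical_range n A \<oplus>\<^sub>s max_k_numerical_range n B))
   \<and> (\<forall>U \<in> max_unitary_mats n.
        max_k_numerical_range k (transpose_mat U \<otimes>\<^sub>m A \<otimes>\<^sub>m U) = max_k_numerical_range k A)
   \<and> ((\<forall>m. \<forall>B \<in> nonneg_mats m m. principal_submatrix B A \<and> k \<le> m \<longrightarrow>
        max_k_numerical_range k B \<subseteq> max_k_numerical_range k A)
      \<and> (\<forall>s is V. length is = s \<and> distinct is \<and> set is \<subseteq> {..<n} \<and> k \<le> s \<and> s \<le> n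
          \<and> V = mat_of_cols n (map (unit_vec n) is) \<longrightarrow>
        max_k_numerical_range k (transpose_mat V \<otimes>\<^sub>m A \<otimes>\<^sub>m V) \<subseteq> max_k_numerical_range k A
        \<and> (s = n \<longrightarrow>
            max_k_numerical_range k (transpose_mat V \<otimes>\<^sub>m A \<otimes>\<^sub>m V) = max_k_numerical_range k A)))
   \<and> max_k_numerical_range k (transpose_mat A) = max_k_numerical_range k A
   \<and> ((k < n \<longrightarrow> max_k_numerical_range (k + 1) A \<subseteq> max_k_numerical_range k A)
      \<and> (\<forall>j. 1 \<le> j \<and> j < n \<longrightarrow> max_k_numerical_range (j + 1) A \<subseteq> max_k_numerical_range j A)
      \<and> (2 \<le> n \<longrightarrow> max_k_numerical_range 2 A \<subseteq> max_numerical_range A))"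
proof -
  have n: "0 < n" and k0: "0 < k" using k by auto
  have distinct_cols: "mat_of_cols n (map (unit_vec n) is) \<in> max_isometries n s"
    if "length is = s" "distinct is" "set is \<subseteq> {..<n}" for s "is"
    unfolding mat_of_cols_unit_vec[OF that(1)]
    using that by (intro selection_mat_isometry) (auto simp: inj_on_nth subset_iff)
  have submat: "max_k_numerical_range k B \<subseteq> max_k_numerical_range k A"
    if B: "B \<in> nonneg_mats m m" and sub: "principal_submatrix B A" and km: "k \<le> m" for m B
  proof -
    have m: "0 < m" using km k0 by simp
    obtain V where "V \<in> max_isometries n m" "B = transpose_mat V \<otimes>\<^sub>m A \<otimes>\<^sub>m V"
      using principal_submatrix_selection[OF A B m sub] .
    then show ?thesis
      using max_k_numerical_range_compression[OF A _ n m] by simp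
  qed
  have cols: "max_k_numerical_range k (transpose_mat V \<otimes>\<^sub>m A \<otimes>\<^sub>m V) \<subseteq> max_k_numerical_range k A
      \<and> (s = n \<longrightarrow>
          max_k_numerical_range k (transpose_mat V \<otimes>\<^sub>m A \<otimes>\<^sub>m V) = max_k_numerical_range k A)"
    if "length is = s \<and> distinct is \<and> set is \<subseteq> {..<n} \<and> k \<le> s \<and> s \<le> n
      \<and> V = mat_of_cols n (map (unit_vec n) is)" for s "is" V
  proof -
    have V: "V \<in> max_isometries n s" and s: "0 < s"
      using that distinct_cols k0 by auto
    show ?thesis
      using max_k_numerical_range_compression[OF A V n s]
        max_k_numerical_range_unitary[OF A square_isometry_unitary n] V n by auto
  qed
  have step: "max_k_numerical_range (j + 1) A \<subseteq> max_k_numerical_range j A" if "1 \<le> j" for j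
    using max_k_numerical_range_Suc_subset[OF A n] that by simp
  have two: "max_k_numerical_range 2 A \<subseteq> max_numerical_range A"
    using step[of 1] by (simp add: max_numerical_range_def numeral_2_eq_2)
  show ?thesis
    apply (intro conjI allI ballI impI)
    subgoal by (rule max_k_numerical_range_affine[OF A n k0])
    subgoal by (rule max_k_numerical_range_oplus_subset[OF A _ n k0])
    subgoal by (rule max_k_numerical_range_full_oplus[OF A _ n])
    subgoal by (rule max_k_numerical_range_unitary[OF A _ n])
    subgoal using submat by blast
    subgoal using cols by blast
    subgoal using cols by blast
    subgoal by (rule max_k_numerical_range_transpose[OF A n])
    subgoal using step k by blast
    subgoal using step by blast
    subgoal by (rule two)
    done
qed

end
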